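(* Let $PA$ be first-order Peano arithmetic with a fixed Gödel numbering. Let $x\,\mathrm{B}\,y$ be the recursive relation on natural numbers that holds iff $x$ is the Gödel number of a $PA$ proof of a $PA$ formula with Gödel number $y$. Let $B(x,y)$ be a $PA$ formula that syntactically defines $x\,\mathrm{B}\,y$ in $PA$, i.e. for all natural numbers $m,n$: if $m\,\mathrm{B}\,n$ holds then $\vdash_{PA} B(\overline{m},\overline{n})$, and if $m\,\mathrm{B}\,n$ does not hold then $\vdash_{PA}\lnot B(\overline{m},\overline{n})$. Let $\mathcal{F}_y$ be any $PA$ formula, with Gödel number $y$. Then: (1) if $PA$ is $\omega$-consistent, then $\vdash_{PA} (\exists x_2)[B(x_2,\overline{y})]$ implies $\vdash_{PA}\mathcal{F}_y$; (2) if $PA$ is consistent, then $\vdash_{PA} (\forall x_2)[\lnot B(x_2,\overline{y})]$ implies $\nvdash_{PA}\mathcal{F}_y$.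
   Context: $PA$ is classical first-order Peano arithmetic (for definiteness, Mendelson's system $S$) in the language with equality $=$, constant $0$, unary successor symbol $S$, binary $+$ and $\times$, and individual variables $x_1,x_2,\ldots$; $(\exists x)\mathcal{B}$ abbreviates $\lnot(\forall x)\lnot\mathcal{B}$. A $PA$ proof of a formula $\mathcal{C}$ is a finite sequence of formulas ending with $\mathcal{C}$, each of which is a $PA$ axiom or follows from earlier formulas in the sequence by a $PA$ inference rule. $\vdash_{PA}\mathcal{F}$ (resp. $\nvdash_{PA}\mathcal{F}$) means that there is (resp. is not) a $PA$ proof of $\mathcal{F}$. $\overline{n}$ is the numeral for the natural number $n$, i.e. $0$ preceded by $n$ applications of $S$. A fixed standard (recursive) Gödel numbering of symbols, formulas and finite sequences of formulas is assumed. $B(x,y)$ has at most the two displayed free variables, and $B(s,t)$ denotes the result of substituting the terms $s,t$ for $x,y$. $PA$ is consistent if there is no formula $\mathcal{F}$ with both $\vdash_{PA}\mathcal{F}$ and $\vdash_{PA}\lnot\mathcal{F}$; $PA$ is $\omega$-consistent if there is no formula $\mathcal{F}(x)$ such that $\vdash_{PA}\lnot\mathcal{F}(\overline{n})$ for every natural number $n$ and also $\vdash_{PA}(\exists x)\mathcal{F}(x)$. *)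

theory Defs
  imports Complex_Main "HOL-Computational_Algebra.Primes" "HOL-Library.Infinite_Set"
begin

section \<open>The language of first-order Peano arithmetic\<close>

text \<open>
  Peano arithmetic is Mendelson's system S. Variables are named: the index \<open>k\<close> stands for the
  variable with subscript \<open>k + 1\<close>, so that the variables are exactly $x_1, x_2, \dots$.
\<close>

type_synonym var = nat

definition x1 :: var where "x1 = 0"
definition x2 :: var where "x2 = 1"
definition x3 :: var where "x3 = 2"

datatype tm = Var var | Zero | Succ tm | Plus tm tm | Times tm tm

datatype fm = Equal tm tm | Neg fm | Imp fm fm | Forall var fm

definition Exists :: "var \<Rightarrow> fm \<Rightarrow> fm" where
  "Exists v A = Neg (Forall v (Neg A))"

fun num :: "nat \<Rightarrow> tm" where
  "num 0 = Zero"
| "num (Suc n) = Succ (num n)"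

fun tvars :: "tm \<Rightarrow> var set" where
  "tvars (Var v) = {v}"
| "tvars Zero = {}"
| "tvars (Succ t) = tvars t"
| "tvars (Plus s t) = tvars s \<union> tvars t"
| "tvars (Times s t) = tvars s \<union> tvars t"

fun fv :: "fm \<Rightarrow> var set" where
  "fv (Equal s t) = tvars s \<union> tvars t"
| "fv (Neg A) = fv A"
| "fv (Imp A C) = fv A \<union> fv C"
| "fv (Forall v A) = fv A - {v}"


section \<open>Substitution\<close>

fun tsubst :: "(var \<Rightarrow> tm) \<Rightarrow> tm \<Rightarrow> tm" where
  "tsubst s (Var v) = s v"
| "tsubst s Zero = Zero"
| "tsubst s (Succ t) = Succ (tsubst s t)"
| "tsubst s (Plus t t') = Plus (tsubst s t) (tsubst s t')"
| "tsubst s (Times t t') = Times (tsubst s t) (tsubst s t')"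

text \<open>
  Simultaneous substitution of terms for the free variables. A bound variable is renamed only
  where it would otherwise capture a variable of a substituted term; whenever the substituted terms
  are free for the variables they replace, this is plain replacement of the free occurrences.
\<close>

fun subst :: "(var \<Rightarrow> tm) \<Rightarrow> fm \<Rightarrow> fm" where
  "subst s (Equal t t') = Equal (tsubst s t) (tsubst s t')"
| "subst s (Neg A) = Neg (subst s A)"
| "subst s (Imp A C) = Imp (subst s A) (subst s C)"
| "subst s (Forall v A) =
     (let W = (\<Union>u \<in> fv A - {v}. tvars (s u));
          w = (if v \<in> W then (LEAST w. w \<notin> W) else v)
      in Forall w (subst (s(v := Var w)) A))"

definition subst1 :: "fm \<Rightarrow> var \<Rightarrow> tm \<Rightarrow> fm" where
  "subst1 A v t = subst (Var(v := t)) A"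

definition subst2 :: "fm \<Rightarrow> var \<Rightarrow> var \<Rightarrow> tm \<Rightarrow> tm \<Rightarrow> fm" where
  "subst2 A u v s t = subst (Var(u := s, v := t)) A"

fun free_for :: "tm \<Rightarrow> var \<Rightarrow> fm \<Rightarrow> bool" where
  "free_for t v (Equal s s') \<longleftrightarrow> True"
| "free_for t v (Neg A) \<longleftrightarrow> free_for t v A"
| "free_for t v (Imp A C) \<longleftrightarrow> free_for t v A \<and> free_for t v C"
| "free_for t v (Forall w A) \<longleftrightarrow>
     v \<notin> fv (Forall w A) \<or> (w \<notin> tvars t \<and> free_for t v A)"


section \<open>Axioms, proofs and provability\<close>

inductive logical_axiom :: "fm \<Rightarrow> bool" where
  A1: "logical_axiom (Imp A (Imp C A))"
| A2: "logical_axiom (Imp (Imp A (Imp C D)) (Imp (Imp A C) (Imp A D)))"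
| A3: "logical_axiom (Imp (Imp (Neg C) (Neg A)) (Imp (Imp (Neg C) A) C))"
| A4: "free_for t v A \<Longrightarrow> logical_axiom (Imp (Forall v A) (subst1 A v t))"
| A5: "v \<notin> fv A \<Longrightarrow> logical_axiom (Imp (Forall v (Imp A C)) (Imp A (Forall v C)))"

inductive proper_axiom :: "fm \<Rightarrow> bool" where
  S1: "proper_axiom (Imp (Equal (Var x1) (Var x2))
                     (Imp (Equal (Var x1) (Var x3)) (Equal (Var x2) (Var x3))))"
| S2: "proper_axiom (Imp (Equal (Var x1) (Var x2)) (Equal (Succ (Var x1)) (Succ (Var x2))))"
| S3: "proper_axiom (Neg (Equal Zero (Succ (Var x1))))"
| S4: "proper_axiom (Imp (Equal (Succ (Var x1)) (Succ (Var x2))) (Equal (Var x1) (Var x2)))"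
| S5: "proper_axiom (Equal (Plus (Var x1) Zero) (Var x1))"
| S6: "proper_axiom (Equal (Plus (Var x1) (Succ (Var x2))) (Succ (Plus (Var x1) (Var x2))))"
| S7: "proper_axiom (Equal (Times (Var x1) Zero) Zero)"
| S8: "proper_axiom (Equal (Times (Var x1) (Succ (Var x2)))
                           (Plus (Times (Var x1) (Var x2)) (Var x1)))"
| S9: "proper_axiom (Imp (subst1 A v Zero)
                     (Imp (Forall v (Imp A (subst1 A v (Succ (Var v))))) (Forall v A)))"

definition PA_axiom :: "fm \<Rightarrow> bool" where
  "PA_axiom A \<longleftrightarrow> logical_axiom A \<or> proper_axiom A"

definition PA_proof :: "fm list \<Rightarrow> fm \<Rightarrow> bool" where
  "PA_proof ps C \<longleftrightarrow>
     ps \<noteq> [] \<and> last ps = C \<and>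
     (\<forall>i < length ps.
        PA_axiom (ps ! i) \<or>
        (\<exists>j < i. \<exists>k < i. ps ! k = Imp (ps ! j) (ps ! i)) \<or>
        (\<exists>j < i. \<exists>v. ps ! i = Forall v (ps ! j)))"

definition PA_provable :: "fm \<Rightarrow> bool" where
  "PA_provable C \<longleftrightarrow> (\<exists>ps. PA_proof ps C)"

definition PA_consistent :: bool where
  "PA_consistent \<longleftrightarrow> \<not> (\<exists>A. PA_provable A \<and> PA_provable (Neg A))"

definition PA_omega_consistent :: bool where
  "PA_omega_consistent \<longleftrightarrow>
     \<not> (\<exists>A v. fv A \<subseteq> {v} \<and>
          (\<forall>n. PA_provable (Neg (subst1 A v (num n)))) \<and>
          PA_provable (Exists v A))"


section \<open>Goedel numbering\<close>

text \<open>
  Formulas are written as strings of symbols in Mendelson's official (fully parenthesized, prefix)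
  notation; the successor, plus, times, equality and zero symbols are his
  $f^1_1$, $f^2_1$, $f^2_2$, $A^2_1$ and $a_1$.
\<close>

datatype symb = LPar | RPar | Comma | NegS | ImpS | ForallS | VarS var | ZeroS
  | SuccS | PlusS | TimesS | EqualS

fun tm_string :: "tm \<Rightarrow> symb list" where
  "tm_string (Var v) = [VarS v]"
| "tm_string Zero = [ZeroS]"
| "tm_string (Succ t) = [SuccS, LPar] @ tm_string t @ [RPar]"
| "tm_string (Plus s t) = [PlusS, LPar] @ tm_string s @ [Comma] @ tm_string t @ [RPar]"
| "tm_string (Times s t) = [TimesS, LPar] @ tm_string s @ [Comma] @ tm_string t @ [RPar]"

fun fm_string :: "fm \<Rightarrow> symb list" where
  "fm_string (Equal s t) = [EqualS, LPar] @ tm_string s @ [Comma] @ tm_string t @ [RPar]"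
| "fm_string (Neg A) = [LPar, NegS] @ fm_string A @ [RPar]"
| "fm_string (Imp A C) = [LPar] @ fm_string A @ [ImpS] @ fm_string C @ [RPar]"
| "fm_string (Forall v A) = [LPar, LPar, ForallS, VarS v, RPar] @ fm_string A @ [RPar]"

text \<open>
  Mendelson's symbol numbers: $13 + 8k$ for $x_k$, $7 + 8k$ for $a_k$,
  $1 + 8 \cdot 2^n 3^k$ for $f^n_k$ and $3 + 8 \cdot 2^n 3^k$ for $A^n_k$.
\<close>

fun symb_gn :: "symb \<Rightarrow> nat" where
  "symb_gn LPar = 3"
| "symb_gn RPar = 5"
| "symb_gn Comma = 7"
| "symb_gn NegS = 9"
| "symb_gn ImpS = 11"
| "symb_gn ForallS = 13"
| "symb_gn (VarS v) = 13 + 8 * (v + 1)"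
| "symb_gn ZeroS = 7 + 8 * 1"
| "symb_gn SuccS = 1 + 8 * (2 ^ 1 * 3 ^ 1)"
| "symb_gn PlusS = 1 + 8 * (2 ^ 2 * 3 ^ 1)"
| "symb_gn TimesS = 1 + 8 * (2 ^ 2 * 3 ^ 2)"
| "symb_gn EqualS = 3 + 8 * (2 ^ 2 * 3 ^ 1)"

definition seq_code :: "nat list \<Rightarrow> nat" where
  "seq_code ns = (\<Prod>i < length ns. enumerate {p. prime p} i ^ (ns ! i))"

definition fm_gn :: "fm \<Rightarrow> nat" where
  "fm_gn A = seq_code (map symb_gn (fm_string A))"

definition proof_gn :: "fm list \<Rightarrow> nat" where
  "proof_gn ps = seq_code (map fm_gn ps)"

definition is_proof_of :: "nat \<Rightarrow> nat \<Rightarrow> bool" where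
  "is_proof_of m n \<longleftrightarrow> (\<exists>ps C. proof_gn ps = m \<and> fm_gn C = n \<and> PA_proof ps C)"

definition syntactically_defines :: "fm \<Rightarrow> var \<Rightarrow> var \<Rightarrow> (nat \<Rightarrow> nat \<Rightarrow> bool) \<Rightarrow> bool" where
  "syntactically_defines B u v R \<longleftrightarrow>
     (\<forall>m n. (R m n \<longrightarrow> PA_provable (subst2 B u v (num m) (num n))) \<and>
            (\<not> R m n \<longrightarrow> PA_provable (Neg (subst2 B u v (num m) (num n)))))"

end

theory Submission
  imports Defs
begin

text \<open>
  That \<open>B\<close> syntactically defines the proof relation turns a question about the numerical relation
  \<^const>\<open>is_proof_of\<close> into theorems of PA. Goedel numbers determine formulas, so \<open>F\<close> is provable iff
  \<open>is_proof_of m y\<close> holds for some \<open>m\<close> (\<open>is_proof_of_fm_gn\<close>).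

  \<^item> If \<open>F\<close> is not provable, then every \<open>m\<close> fails to be a proof, so PA proves every numerical instance
    of \<open>\<not> B(x2, y)\<close>; an omega-consistent PA then does not prove \<open>\<exists>x2. B(x2, y)\<close>.
  \<^item> If \<open>F\<close> is provable, then PA proves \<open>B(m, y)\<close> for the number \<open>m\<close> of a proof, and a consistent PA does
    not prove \<open>\<forall>x2. \<not> B(x2, y)\<close>.

  Both arguments silently identify \<open>B(m, y)\<close> with the result of putting the numeral of \<open>m\<close> for \<open>x2\<close> in
  \<open>B(x2, y)\<close>. These formulas can differ: if \<open>x2\<close> is bound somewhere in \<open>B\<close>, forming \<open>B(x2, y)\<close> may rename
  that bound variable, whereas forming \<open>B(m, y)\<close> renames nothing. So the identification holds only
  up to the names of bound variables, and PA has to be shown to prove such formulas equivalent.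
  That is \<open>subst_subst_eqv\<close>: performing two substitutions in succession is provably equivalent to
  performing their composition at once.

  Injectivity of the numbering combines unique readability of the official notation, injectivity
  of the symbol numbers, and unique prime factorization.
\<close>

section \<open>Closure properties of provability\<close>

lemma PA_provable_axiom: "PA_axiom A \<Longrightarrow> PA_provable A"
  unfolding PA_provable_def PA_proof_def by (rule exI[of _ "[A]"]) simp

lemma PA_provable_logical: "logical_axiom A \<Longrightarrow> PA_provable A"
  by (simp add: PA_provable_axiom PA_axiom_def)

text \<open>
  The condition on a line of a proof in terms of the set of its predecessors. It is monotone
  in that set, which makes proofs easy to concatenate.
\<close>

definition PA_justified :: "fm list \<Rightarrow> fm \<Rightarrow> bool" where
  "PA_justified ps C \<longleftrightarrow> PA_axiom C \<or> (\<exists>A\<in>set ps. Imp A C \<in> set ps) \<or>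
     (\<exists>A\<in>set ps. \<exists>v. C = Forall v A)"

lemma PA_proof_iff_justified:
  "PA_proof ps C \<longleftrightarrow> ps \<noteq> [] \<and> last ps = C \<and> (\<forall>i < length ps. PA_justified (take i ps) (ps ! i))"
proof -
  have "PA_justified (take i ps) (ps ! i) \<longleftrightarrow> PA_axiom (ps ! i) \<or>
        (\<exists>j < i. \<exists>k < i. ps ! k = Imp (ps ! j) (ps ! i)) \<or>
        (\<exists>j < i. \<exists>v. ps ! i = Forall v (ps ! j))" if "i < length ps" for i
  proof -
    have "A \<in> set (take i ps) \<longleftrightarrow> (\<exists>j<i. A = ps ! j)" for A
      using that by (auto simp: in_set_conv_nth)
    then show ?thesis
      unfolding PA_justified_def by metis
  qed
  then show ?thesis
    unfolding PA_proof_def by metis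
qed

lemma PA_justified_mono: "PA_justified ps C \<Longrightarrow> set ps \<subseteq> set qs \<Longrightarrow> PA_justified qs C"
  unfolding PA_justified_def by blast

lemma all_justified_append:
  assumes "\<forall>i < length ps. PA_justified (take i ps) (ps ! i)"
    and "\<forall>i < length qs. PA_justified (take i qs) (qs ! i)"
  shows "\<forall>i < length (ps @ qs). PA_justified (take i (ps @ qs)) ((ps @ qs) ! i)"
proof (intro allI impI)
  fix i assume i: "i < length (ps @ qs)"
  show "PA_justified (take i (ps @ qs)) ((ps @ qs) ! i)"
  proof (cases "i < length ps")
    case True
    then show ?thesis using assms(1) by (simp add: nth_append)
  next
    case False
    then have "PA_justified (take (i - length ps) qs) (qs ! (i - length ps))"
      using assms(2) i by simp
    then show ?thesis
      using False by (auto simp: nth_append intro: PA_justified_mono)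
  qed
qed

lemma PA_proof_snoc:
  assumes "\<forall>i < length ps. PA_justified (take i ps) (ps ! i)" and "PA_justified ps C"
  shows "PA_proof (ps @ [C]) C"
  unfolding PA_proof_iff_justified using assms by (auto simp: nth_append less_Suc_eq)

lemma PA_provable_mp:
  assumes "PA_provable (Imp A C)" and "PA_provable A"
  shows "PA_provable C"
proof -
  obtain ps qs where p: "PA_proof ps (Imp A C)" and q: "PA_proof qs A"
    using assms unfolding PA_provable_def by blast
  have "Imp A C \<in> set (ps @ qs)" "A \<in> set (ps @ qs)"
    using p q unfolding PA_proof_iff_justified by (metis Un_iff last_in_set set_append)+
  then have "PA_justified (ps @ qs) C"
    unfolding PA_justified_def by blast
  moreover have "\<forall>i < length (ps @ qs). PA_justified (take i (ps @ qs)) ((ps @ qs) ! i)"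
    using p q unfolding PA_proof_iff_justified by (intro all_justified_append) simp_all
  ultimately have "PA_proof ((ps @ qs) @ [C]) C"
    by (intro PA_proof_snoc)
  then show ?thesis
    unfolding PA_provable_def by blast
qed

lemma PA_provable_gen:
  assumes "PA_provable A"
  shows "PA_provable (Forall v A)"
proof -
  obtain ps where p: "PA_proof ps A"
    using assms unfolding PA_provable_def by blast
  have "A \<in> set ps"
    using p unfolding PA_proof_iff_justified by (metis last_in_set)
  then have "PA_justified ps (Forall v A)"
    unfolding PA_justified_def by blast
  then have "PA_proof (ps @ [Forall v A]) (Forall v A)"
    using p unfolding PA_proof_iff_justified[of ps] by (intro PA_proof_snoc) simp_all
  then show ?thesis
    unfolding PA_provable_def by blast
qed

section \<open>Propositional reasoning\<close>

lemma weaken: "PA_provable A \<Longrightarrow> PA_provable (Imp C A)"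
  by (rule PA_provable_mp[OF PA_provable_logical[OF A1]])

lemma imp_mp: "PA_provable (Imp A (Imp C D)) \<Longrightarrow> PA_provable (Imp A C) \<Longrightarrow> PA_provable (Imp A D)"
  by (rule PA_provable_mp[OF PA_provable_mp[OF PA_provable_logical[OF A2]]])

lemma imp_trans: "PA_provable (Imp A C) \<Longrightarrow> PA_provable (Imp C D) \<Longrightarrow> PA_provable (Imp A D)"
  by (rule imp_mp[OF weaken])

lemma imp_refl: "PA_provable (Imp A A)"
  by (rule imp_mp[OF PA_provable_logical[OF A1] PA_provable_logical[OF A1[of A A]]])

lemma imp_mono_right: "PA_provable (Imp C D) \<Longrightarrow> PA_provable (Imp (Imp A C) (Imp A D))"
  by (rule PA_provable_mp[OF PA_provable_logical[OF A2] weaken])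

lemma imp_mono_left: 
  assumes "PA_provable (Imp A C)"
  shows "PA_provable (Imp (Imp C D) (Imp A D))"
proof -
  have "PA_provable (Imp (Imp C D) (Imp A (Imp C D)))"
    by (rule PA_provable_logical[OF A1])
  then have "PA_provable (Imp (Imp C D) (Imp (Imp A C) (Imp A D)))"
    by (rule imp_trans[OF _ PA_provable_logical[OF A2]])
  then show ?thesis
    by (rule imp_mp[OF _ weaken[OF assms]])
qed

lemma double_neg_elim: "PA_provable (Imp (Neg (Neg A)) A)"
proof -
  have "PA_provable (Imp (Neg (Neg A)) (Imp (Imp (Neg A) (Neg A)) A))"
    using imp_trans[OF PA_provable_logical[OF A1] PA_provable_logical[OF A3]] .
  then show ?thesis
    by (rule imp_mp[OF _ weaken[OF imp_refl]])
qed

lemma contrapos: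
  assumes "PA_provable (Imp A C)"
  shows "PA_provable (Imp (Neg C) (Neg A))"
proof -
  have "PA_provable (Imp (Neg C) (Imp (Imp (Neg (Neg A)) C) (Neg A)))"
    using imp_trans[OF PA_provable_logical[OF A1] PA_provable_logical[OF A3]] .
  moreover have "PA_provable (Imp (Neg (Neg A)) C)"
    using imp_trans[OF double_neg_elim assms] .
  ultimately show ?thesis
    by (rule imp_mp[OF _ weaken])
qed


section \<open>Free variables and substitution\<close>

lemma finite_tvars: "finite (tvars t)"
  by (induction t) auto

lemma finite_fv: "finite (fv A)"
  by (induction A) (auto simp: finite_tvars)

lemma tsubst_cong: "(\<And>x. x \<in> tvars t \<Longrightarrow> s x = r x) \<Longrightarrow> tsubst s t = tsubst r t"
  by (induction t) auto

lemma tsubst_Var: "tsubst Var t = t"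
  by (induction t) auto

lemma tsubst_tsubst: "tsubst r (tsubst s t) = tsubst (\<lambda>x. tsubst r (s x)) t"
  by (induction t) auto

lemma tvars_tsubst: "tvars (tsubst s t) = (\<Union>x\<in>tvars t. tvars (s x))"
  by (induction t) auto

lemma tsubst_closed: "tvars t = {} \<Longrightarrow> tsubst s t = t"
  by (induction t) auto

lemma tvars_num: "tvars (num n) = {}"
  by (induction n) auto

text \<open>
  For free variables and for provable equivalence, all that matters about the renaming under a
  quantifier is that the new bound variable captures nothing. A least such variable exists because
  only finitely many variables occur in the substituted terms.
\<close>

lemma subst_Forall_obtain:
  obtains w where "subst s (Forall v A) = Forall w (subst (s(v := Var w)) A)"
    and "w \<notin> (\<Union>x \<in> fv A - {v}. tvars (s x))"
proof -
  let ?W = "\<Union>x \<in> fv A - {v}. tvars (s x)"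
  have "\<exists>w. w \<notin> ?W"
    by (rule ex_new_if_finite) (auto simp: finite_fv finite_tvars)
  then have "(LEAST w. w \<notin> ?W) \<notin> ?W"
    by (rule LeastI_ex)
  then show thesis
    using that[of "if v \<in> ?W then LEAST w. w \<notin> ?W else v"] by (auto simp: Let_def)
qed

lemma subst_Forall_no_capture:
  "v \<notin> (\<Union>x \<in> fv A - {v}. tvars (s x)) \<Longrightarrow>
     subst s (Forall v A) = Forall v (subst (s(v := Var v)) A)"
  by (auto simp: Let_def)

declare subst.simps(4) [simp del]

lemma subst_cong: "(\<And>x. x \<in> fv A \<Longrightarrow> s x = r x) \<Longrightarrow> subst s A = subst r A"
proof (induction A arbitrary: s r)
  case (Equal t t')
  then show ?case by (auto intro: tsubst_cong)
next
  case (Forall v A)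
  have eq: "s x = r x" if "x \<in> fv A - {v}" for x
    using Forall.prems that by simp
  have "subst (s(v := Var w)) A = subst (r(v := Var w)) A" for w
    by (rule Forall.IH) (use eq in auto)
  moreover have "(\<Union>x \<in> fv A - {v}. tvars (s x)) = (\<Union>x \<in> fv A - {v}. tvars (r x))"
    using eq by simp
  ultimately show ?case
    by (simp only: subst.simps(4) Let_def)
next
  case (Imp A C)
  show ?case
    using Imp.IH(1)[of s r] Imp.IH(2)[of s r] Imp.prems by simp
next
  case (Neg A)
  show ?case
    using Neg.IH[of s r] Neg.prems by simp
qed

lemma subst_Var: "subst Var A = A"
proof (induction A)
  case (Forall v A)
  then show ?case by (simp add: subst_Forall_no_capture)
qed (simp_all add: tsubst_Var)

lemma subst1_not_free: "v \<notin> fv A \<Longrightarrow> subst1 A v t = A"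
  unfolding subst1_def by (subst subst_Var[of A, symmetric], rule subst_cong) auto

lemma subst1_self: "subst1 A v (Var v) = A"
  unfolding subst1_def by (simp add: subst_Var)

lemma fv_subst: "fv (subst s A) = (\<Union>x\<in>fv A. tvars (s x))"
proof (induction A arbitrary: s)
  case (Forall v A)
  obtain w where "subst s (Forall v A) = Forall w (subst (s(v := Var w)) A)"
    and "w \<notin> (\<Union>x \<in> fv A - {v}. tvars (s x))"
    by (rule subst_Forall_obtain)
  then show ?case using Forall.IH by (auto split: if_splits)
qed (auto simp: tvars_tsubst)

lemma free_for_self: "free_for (Var v) v A"
  by (induction A) auto

lemma free_for_closed: "tvars t = {} \<Longrightarrow> free_for t v A"
  by (induction A) auto


section \<open>Quantifier rules and provable equivalence\<close>

lemma PA_provable_spec: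
  "PA_provable (Forall v A) \<Longrightarrow> free_for t v A \<Longrightarrow> PA_provable (subst1 A v t)"
  by (rule PA_provable_mp[OF PA_provable_logical[OF A4]])

lemma imp_forall_intro:
  "PA_provable (Imp A C) \<Longrightarrow> v \<notin> fv A \<Longrightarrow> PA_provable (Imp A (Forall v C))"
  by (rule PA_provable_mp[OF PA_provable_logical[OF A5] PA_provable_gen])

lemma forall_elim: "PA_provable (Imp (Forall v A) A)"
  using PA_provable_logical[OF A4, OF free_for_self] by (simp add: subst1_self)

text \<open>
  Two implications instead of one formula, since the language has neither a biconditional nor a
  conjunction.
\<close>

definition eqv :: "fm \<Rightarrow> fm \<Rightarrow> bool" where
  "eqv A C \<longleftrightarrow> PA_provable (Imp A C) \<and> PA_provable (Imp C A)"

lemma eqv_refl: "eqv A A"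
  by (simp add: eqv_def imp_refl)

lemma eqv_sym: "eqv A C \<Longrightarrow> eqv C A"
  by (simp add: eqv_def)

lemma eqv_trans [trans]: "eqv A C \<Longrightarrow> eqv C D \<Longrightarrow> eqv A D"
  unfolding eqv_def by (auto intro: imp_trans)

lemma eqv_provable: "eqv A C \<Longrightarrow> PA_provable A \<Longrightarrow> PA_provable C"
  unfolding eqv_def by (auto intro: PA_provable_mp)

lemma eqv_Neg: "eqv A C \<Longrightarrow> eqv (Neg A) (Neg C)"
  by (simp add: eqv_def contrapos)

lemma eqv_Imp: "eqv A A' \<Longrightarrow> eqv C C' \<Longrightarrow> eqv (Imp A C) (Imp A' C')"
  unfolding eqv_def by (auto intro: imp_trans[OF imp_mono_left imp_mono_right])

lemma eqv_Forall: "eqv A C \<Longrightarrow> eqv (Forall v A) (Forall v C)"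
  unfolding eqv_def by (auto intro!: imp_forall_intro intro: imp_trans[OF forall_elim])


section \<open>Renaming bound variables\<close>

fun all_vars :: "fm \<Rightarrow> var set" where
  "all_vars (Equal s t) = tvars s \<union> tvars t"
| "all_vars (Neg A) = all_vars A"
| "all_vars (Imp A C) = all_vars A \<union> all_vars C"
| "all_vars (Forall v A) = insert v (all_vars A)"

lemma finite_all_vars: "finite (all_vars A)"
  by (induction A) (auto simp: finite_tvars)

lemma fv_subset_all_vars: "fv A \<subseteq> all_vars A"
  by (induction A) auto

lemma subst1_Var_Forall:
  assumes "z \<noteq> x"
  shows "subst1 (Forall x A) w (Var z) = Forall x (if x = w then A else subst1 A w (Var z))"
proof -
  have "subst1 (Forall x A) w (Var z) = Forall x (subst ((Var(w := Var z))(x := Var x)) A)"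
    unfolding subst1_def by (rule subst_Forall_no_capture) (use assms in auto)
  moreover have "(Var(w := Var z))(x := Var x) = (if x = w then Var else Var(w := Var z))"
    by auto
  ultimately show ?thesis
    by (simp add: subst1_def subst_Var)
qed

lemma tsubst_rename_back:
  "z \<notin> tvars t \<Longrightarrow> tsubst (Var(z := Var w)) (tsubst (Var(w := Var z)) t) = t"
  by (induction t) auto

text \<open>
  A variable that occurs nowhere, not even bound, leaves no trace: replacing \<open>w\<close> by it triggers no
  renaming, and the replacement can be undone exactly. The point is that \<open>w\<close> is free for \<open>z\<close> in the
  result even if \<open>A\<close> has quantifiers over \<open>w\<close>, because \<open>z\<close> stands only where \<open>w\<close> was free.
\<close>

lemma rename_back:
  assumes "z \<notin> all_vars A"
  shows "free_for (Var w) z (subst1 A w (Var z)) \<and> subst1 (subst1 A w (Var z)) z (Var w) = A"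
  using assms
proof (induction A)
  case (Equal s t)
  then show ?case by (simp add: subst1_def tsubst_rename_back)
next
  case (Forall x A)
  then have "z \<noteq> x" and "z \<notin> fv A"
    using fv_subset_all_vars[of A] by auto
  then show ?case
    using Forall by (cases "x = w") (auto simp: subst1_Var_Forall subst1_not_free)
qed (simp_all add: subst1_def)

text \<open>
  Renaming a quantified variable to a wholly unused one: instantiate in each direction and
  generalize. The backward instance is legitimate by \<open>rename_back\<close>.
\<close>

lemma eqv_rename:
  assumes z: "z \<notin> all_vars A"
  shows "eqv (Forall w A) (Forall z (subst1 A w (Var z)))"
  unfolding eqv_def
proof
  have "free_for (Var z) w A"
    using z by (induction A) auto
  then have "PA_provable (Imp (Forall w A) (subst1 A w (Var z)))"
    by (rule PA_provable_logical[OF A4])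
  moreover have "z \<notin> fv (Forall w A)"
    using z fv_subset_all_vars by auto
  ultimately show "PA_provable (Imp (Forall w A) (Forall z (subst1 A w (Var z))))"
    by (rule imp_forall_intro)
next
  have "PA_provable (Imp (Forall z (subst1 A w (Var z))) A)"
    using PA_provable_logical[OF A4, of "Var w" z "subst1 A w (Var z)"] rename_back[OF z, of w]
    by simp
  moreover have "w \<notin> fv (Forall z (subst1 A w (Var z)))"
    by (auto simp: subst1_def fv_subst split: if_splits)
  ultimately show "PA_provable (Imp (Forall z (subst1 A w (Var z))) (Forall w A))"
    by (rule imp_forall_intro)
qed

text \<open>
  In the quantifier case the two sides are, up to the induction hypothesis, quantifications
  \<open>Forall b\<close> and \<open>Forall c\<close> of the same formula with \<open>b\<close> or \<open>c\<close> for the bound variable. They cannot be compared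
  directly: \<open>c\<close> need not be free for \<open>b\<close>, and since the bodies are themselves results of substitution,
  the choice of \<open>b\<close> or \<open>c\<close> may have influenced the renamings inside them. Both are therefore renamed to a
  variable \<open>z\<close> occurring in neither body. The renaming is again a substitution after a
  substitution, so the induction hypothesis, which is available for all substitutions,
  identifies both results with the body for \<open>z\<close>.
\<close>

lemma subst_subst_eqv: "eqv (subst r (subst s A)) (subst (\<lambda>x. tsubst r (s x)) A)"
proof (induction A arbitrary: r s)
  case (Equal t t')
  then show ?case by (simp add: tsubst_tsubst eqv_refl)
next
  case (Neg A)
  then show ?case by (simp add: eqv_Neg)
next
  case (Imp A C)
  then show ?case by (simp add: eqv_Imp)
next
  case (Forall v A)
  let ?q = "\<lambda>x. tsubst r (s x)"
  let ?W = "\<Union>x \<in> fv A - {v}. tvars (?q x)"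
  obtain a where a: "subst s (Forall v A) = Forall a (subst (s(v := Var a)) A)"
    and a_new: "a \<notin> (\<Union>x \<in> fv A - {v}. tvars (s x))"
    by (rule subst_Forall_obtain)
  obtain b where b: "subst r (Forall a (subst (s(v := Var a)) A)) =
      Forall b (subst (r(a := Var b)) (subst (s(v := Var a)) A))"
    and b_new: "b \<notin> (\<Union>x \<in> fv (subst (s(v := Var a)) A) - {a}. tvars (r x))"
    by (rule subst_Forall_obtain)
  obtain c where c: "subst ?q (Forall v A) = Forall c (subst (?q(v := Var c)) A)"
    and c_new: "c \<notin> ?W"
    by (rule subst_Forall_obtain)
  have b_new': "b \<notin> ?W"
    using a_new b_new by (fastforce simp: fv_subst tvars_tsubst)
  have comp: "subst (\<lambda>x. tsubst (r(a := Var b)) ((s(v := Var a)) x)) A = subst (?q(v := Var b)) A"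
    by (rule subst_cong) (use a_new in \<open>auto intro!: tsubst_cong\<close>)
  have "finite (all_vars (subst (?q(v := Var b)) A) \<union> all_vars (subst (?q(v := Var c)) A))"
    by (simp add: finite_all_vars)
  then obtain z where z: "z \<notin> all_vars (subst (?q(v := Var b)) A)"
    "z \<notin> all_vars (subst (?q(v := Var c)) A)"
    using ex_new_if_finite[OF infinite_UNIV_nat] by blast
  \<comment> \<open>The same renaming serves \<open>b\<close> and \<open>c\<close>, since neither captures anything in the composed substitution.\<close>
  have to_z: "eqv (Forall w (subst (?q(v := Var w)) A)) (Forall z (subst (?q(v := Var z)) A))"
    if w: "w \<notin> ?W" and z: "z \<notin> all_vars (subst (?q(v := Var w)) A)" for w
  proof -
    have "eqv (subst1 (subst (?q(v := Var w)) A) w (Var z))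
        (subst (\<lambda>x. tsubst (Var(w := Var z)) ((?q(v := Var w)) x)) A)"
      unfolding subst1_def by (rule Forall.IH)
    also have "subst (\<lambda>x. tsubst (Var(w := Var z)) ((?q(v := Var w)) x)) A = subst (?q(v := Var z)) A"
    proof (rule subst_cong)
      fix x assume x: "x \<in> fv A"
      show "tsubst (Var(w := Var z)) ((?q(v := Var w)) x) = (?q(v := Var z)) x"
      proof (cases "x = v")
        case False
        then have "w \<notin> tvars (?q x)" using x w by blast
        then have "tsubst (Var(w := Var z)) (?q x) = tsubst Var (?q x)"
          by (intro tsubst_cong) auto
        then show ?thesis using False by (simp add: tsubst_Var)
      qed simp
    qed
    finally show ?thesis
      by (rule eqv_trans[OF eqv_rename[OF z] eqv_Forall])
  qed
  have "eqv (subst r (subst s (Forall v A))) (Forall b (subst (?q(v := Var b)) A))"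
    unfolding a b using Forall.IH[of "r(a := Var b)" "s(v := Var a)"] unfolding comp
    by (rule eqv_Forall)
  also have "eqv \<dots> (Forall z (subst (?q(v := Var z)) A))"
    using b_new' z(1) by (rule to_z)
  also have "eqv \<dots> (subst ?q (Forall v A))"
    unfolding c using c_new z(2) by (rule eqv_sym[OF to_z])
  finally show ?case .
qed


section \<open>Injectivity of the numbering\<close>

text \<open>
  Unique readability is proved in its prefix-free form, which is what the induction needs: a term
  or formula must be recognized in front of an arbitrary rest of the string.
\<close>

lemma tm_string_prefix_free:
  "tm_string s @ xs = tm_string t @ ys \<Longrightarrow> s = t \<and> xs = ys"
proof (induction s arbitrary: t xs ys)
  case (Succ s)
  from Succ.prems show ?case by (cases t) (auto dest!: Succ.IH)
next
  case (Plus s s')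
  from Plus.prems show ?case by (cases t) (auto dest!: Plus.IH)
next
  case (Times s s')
  from Times.prems show ?case by (cases t) (auto dest!: Times.IH)
next
  case (Var v)
  then show ?case by (cases t) auto
next
  case Zero
  then show ?case by (cases t) auto
qed

lemma fm_string_head:
  "fm_string A @ xs \<noteq> NegS # ys" "fm_string A @ xs \<noteq> ForallS # ys"
  by (cases A; simp)+

text \<open>
  Universal quantifications and implications both begin with a left parenthesis. They are told
  apart because the left-hand side of an implication does not begin like the parenthesized
  quantifier.
\<close>

lemma fm_string_not_quantifier: "fm_string A @ xs \<noteq> LPar # ForallS # ys"
  by (cases A) (auto simp: fm_string_head)

lemma fm_string_prefix_free:
  "fm_string A @ xs = fm_string C @ ys \<Longrightarrow> A = C \<and> xs = ys"
proof (induction A arbitrary: C xs ys)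
  case (Equal s t)
  from Equal.prems show ?case
    by (cases C) (auto dest!: tm_string_prefix_free)
next
  case (Neg A)
  from Neg.prems show ?case
    by (cases C) (auto dest!: Neg.IH simp: fm_string_head fm_string_head[symmetric])
next
  case (Imp A D)
  from Imp.prems show ?case
    by (cases C) (auto dest!: Imp.IH simp: fm_string_head fm_string_not_quantifier)
next
  case (Forall v A)
  from Forall.prems show ?case
    by (cases C) (auto dest!: Forall.IH simp: fm_string_not_quantifier[symmetric])
qed

lemma inj_fm_string: "inj fm_string"
  by (rule injI) (metis append_Nil2 fm_string_prefix_free)

lemma inj_symb_gn: "inj symb_gn"
proof (rule injI)
  fix a b show "symb_gn a = symb_gn b \<Longrightarrow> a = b"
    by (cases a; cases b; simp; presburger)
qed

lemma symb_gn_nonzero: "symb_gn a \<noteq> 0"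
  by (cases a) auto

lemma multiplicity_seq_code:
  "multiplicity (enumerate {p. prime p} k) (seq_code ns) = (if k < length ns then ns ! k else 0)"
proof -
  let ?p = "enumerate {p::nat. prime p}"
  have prime: "prime (?p i)" for i
    using enumerate_in_set[OF primes_infinite] by simp
  have exponent: "multiplicity (?p k) (?p i ^ n) = (if i = k then n else 0)" for i n
    using prime inj_enumerate[OF primes_infinite]
    by (auto simp: multiplicity_distinct_prime_power inj_eq)
  have "0 \<notin> (\<lambda>i. ?p i ^ (ns ! i)) ` {..<length ns}"
    using prime by (metis (no_types, lifting) imageE not_prime_0 power_not_zero)
  then have "multiplicity (?p k) (seq_code ns) =
      (\<Sum>i<length ns. multiplicity (?p k) (?p i ^ (ns ! i)))"
    unfolding seq_code_def using prime
    by (intro prime_elem_multiplicity_prod_distrib) auto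
  then show ?thesis
    by (simp add: exponent)
qed

text \<open>
  A zero entry would contribute the factor 1, so that trailing zeros would be lost; for positive
  entries the exponents of the primes also reveal the length.
\<close>

lemma seq_code_inject:
  assumes "seq_code ms = seq_code ns" and pos: "0 \<notin> set ms" "0 \<notin> set ns"
  shows "ms = ns"
proof -
  have eq: "(if k < length ms then ms ! k else 0) = (if k < length ns then ns ! k else 0)" for k
    using assms(1) multiplicity_seq_code by metis
  have "k < length ms \<longleftrightarrow> k < length ns" for k
    using eq[of k] pos nth_mem by (metis (full_types))
  then have "length ms = length ns"
    by (metis linorder_neqE_nat less_irrefl)
  then show ?thesis
    using eq by (metis nth_equalityI)
qed

lemma inj_fm_gn: "inj fm_gn"
proof (rule injI)
  fix A C assume "fm_gn A = fm_gn C"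
  then have "map symb_gn (fm_string A) = map symb_gn (fm_string C)"
    unfolding fm_gn_def by (rule seq_code_inject) (auto simp: symb_gn_nonzero dest: sym)
  then show "A = C"
    using inj_symb_gn inj_fm_string by (meson inj_eq inj_map)
qed

text \<open>
  Here injectivity is indispensable: a number \<open>m\<close> related to the number of \<open>F\<close> encodes a proof of some
  formula with that number, which must be \<open>F\<close> itself.
\<close>

lemma is_proof_of_fm_gn: "(\<exists>m. is_proof_of m (fm_gn F)) \<longleftrightarrow> PA_provable F"
  unfolding is_proof_of_def PA_provable_def using inj_eq[OF inj_fm_gn] by metis

theorem proposition3p22:
  fixes B F :: fm and u v :: var and y :: nat
  assumes "u \<noteq> v"
    and "fv B \<subseteq> {u, v}"
    and "syntactically_defines B u v is_proof_of"
    and "y = fm_gn F"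
  shows "(PA_omega_consistent \<longrightarrow>
            PA_provable (Exists x2 (subst2 B u v (Var x2) (num y))) \<longrightarrow> PA_provable F) \<and>
         (PA_consistent \<longrightarrow>
            PA_provable (Forall x2 (Neg (subst2 B u v (Var x2) (num y)))) \<longrightarrow> \<not> PA_provable F)"
proof -
  let ?A = "subst2 B u v (Var x2) (num y)"
  have fv: "fv ?A \<subseteq> {x2}"
    using assms(1,2) by (auto simp: subst2_def fv_subst tvars_num split: if_splits)
  have inst: "eqv (subst1 ?A x2 (num n)) (subst2 B u v (num n) (num y))" for n
  proof -
    have "eqv (subst1 ?A x2 (num n))
        (subst (\<lambda>x. tsubst (Var(x2 := num n)) ((Var(u := Var x2, v := num y)) x)) B)"
      unfolding subst1_def subst2_def by (rule subst_subst_eqv)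
    also have "\<dots> = subst2 B u v (num n) (num y)"
      unfolding subst2_def using assms(1,2)
      by (intro subst_cong) (auto simp: tsubst_closed tvars_num)
    finally show ?thesis .
  qed
  show ?thesis
  proof (intro conjI impI)
    assume omega: PA_omega_consistent and ex: "PA_provable (Exists x2 ?A)"
    show "PA_provable F"
    proof (rule ccontr)
      assume "\<not> PA_provable F"
      then have "\<not> is_proof_of n y" for n
        using is_proof_of_fm_gn assms(4) by blast
      then have "PA_provable (Neg (subst2 B u v (num n) (num y)))" for n
        using assms(3) unfolding syntactically_defines_def by blast
      then have "PA_provable (Neg (subst1 ?A x2 (num n)))" for n
        using eqv_provable[OF eqv_sym[OF eqv_Neg[OF inst]]] by simp
      then show False
        using omega ex fv unfolding PA_omega_consistent_def by blast
    qed
  next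
    assume con: PA_consistent and all: "PA_provable (Forall x2 (Neg ?A))"
    show "\<not> PA_provable F"
    proof
      assume "PA_provable F"
      then obtain m where "is_proof_of m y"
        using is_proof_of_fm_gn assms(4) by blast
      then have "PA_provable (subst2 B u v (num m) (num y))"
        using assms(3) unfolding syntactically_defines_def by blast
      moreover have "PA_provable (Neg (subst1 ?A x2 (num m)))"
        using PA_provable_spec[OF all free_for_closed[OF tvars_num]] by (simp add: subst1_def)
      then have "PA_provable (Neg (subst2 B u v (num m) (num y)))"
        by (rule eqv_provable[OF eqv_Neg[OF inst]])
      ultimately show False
        using con unfolding PA_consistent_def by blast
    qed
  qed
qed

end
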